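(* Let $\Phi=(D,\varphi)$ be a $\mathbb{T}$-gain digraph on $n$ vertices. Then $$\det L(\Phi)=\sum_{\mathsf{E}\in\mathcal{E}(D)}(-1)^{c(\mathsf{E})}\varphi(\mathsf{E})\prod_{v\notin V(\mathsf{E})}\deg^{+}(v),$$ and $$\det Q(\Phi)=\sum_{\mathsf{E}\in\mathcal{E}(D)}(-1)^{|V(\mathsf{E})|+c(\mathsf{E})}\varphi(\mathsf{E})\prod_{v\notin V(\mathsf{E})}\deg^{+}(v),$$ where the summation is over all elementary subdigraphs of $D$.
   Context: A digraph $D=(V,\mathcal{A})$ has a finite vertex set $V=\{v_1,\dots,v_n\}$ and a set $\mathcal{A}$ of ordered pairs of distinct vertices, called arcs (no loops; at most one arc from $v_i$ to $v_j$ for each ordered pair; opposite arcs may both be present). The out-degree $\deg^+(v)$ is the number of arcs leaving $v$. A directed cycle is a closed directed walk whose vertices are distinct except that the first and last coincide (so its length is at least $2$; length $2$ is allowed). Let $\mathbb{T}=\{z\in\mathbb{C}:|z|=1\}$. A $\mathbb{T}$-gain digraph is a pair $\Phi=(D,\varphi)$ with $\varphi:\mathcal{A}\to\mathbb{T}$ an arbitrary function. Its gain adjacency matrix $A(\Phi)$ has entries $A(\Phi)_{ij}=\varphi(v_i,v_j)$ if $(v_i,v_j)\in\mathcal{A}$ and $0$ otherwise. With $D^+=\operatorname{diag}(\deg^+(v_1),\dots,\deg^+(v_n))$, set $L(\Phi)=D^+-A(\Phi)$ and $Q(\Phi)=D^++A(\Phi)$. An elementary subdigraph of $D$ is a subdigraph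 in which every vertex has in-degree and out-degree exactly $1$, equivalently a vertex-disjoint union of directed cycles of $D$. $\mathcal{E}(D)$ is the set of all elementary subdigraphs of $D$ covering any number of vertices, including the empty one $\mathsf{E}=\emptyset$ (for which $c(\mathsf{E})=0$, $V(\mathsf{E})=\emptyset$, $\varphi(\mathsf{E})=1$). $V(\mathsf{E})$ is the vertex set of $\mathsf{E}$, $c(\mathsf{E})$ the number of directed cycles composing it, and $\varphi(\mathsf{E})$ the product of the gains of these cycles, the gain of a directed cycle being the product of the gains of its arcs. *)

theory Defs
  imports
    Complex_Main
    "Graph_Theory.Digraph_Component"
    "Jordan_Normal_Form.Determinant"
begin

text \<open>A locale \<^locale>\<open>pair_digraph\<close> is a finite loopless digraph whose arcs are ordered pairs of
  vertices.  The gain function is total in HOL; its values off the arc set are never used.\<close>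

locale T_gain_digraph = pair_digraph D
  for D :: "'v pair_pre_digraph" +
  fixes \<phi> :: "'v \<times> 'v \<Rightarrow> complex"
  assumes unit_gain: "a \<in> parcs D \<Longrightarrow> cmod (\<phi> a) = 1"

text \<open>The vertices are listed as \<open>v 0, \<dots>, v (n - 1)\<close>: matrix indices start at 0.\<close>

definition gain_adj_mat ::
  "nat \<Rightarrow> (nat \<Rightarrow> 'v) \<Rightarrow> 'v pair_pre_digraph \<Rightarrow> ('v \<times> 'v \<Rightarrow> complex) \<Rightarrow> complex mat" where
  "gain_adj_mat n v D \<phi> =
     mat n n (\<lambda>(i, j). if (v i, v j) \<in> parcs D then \<phi> (v i, v j) else 0)"

definition out_degree_mat ::
  "nat \<Rightarrow> (nat \<Rightarrow> 'v) \<Rightarrow> 'v pair_pre_digraph \<Rightarrow> complex mat" where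
  "out_degree_mat n v D = mat_diag n (\<lambda>i. of_nat (out_degree (with_proj D) (v i)))"

definition gain_laplacian ::
  "nat \<Rightarrow> (nat \<Rightarrow> 'v) \<Rightarrow> 'v pair_pre_digraph \<Rightarrow> ('v \<times> 'v \<Rightarrow> complex) \<Rightarrow> complex mat" where
  "gain_laplacian n v D \<phi> = out_degree_mat n v D - gain_adj_mat n v D \<phi>"

definition gain_signless_laplacian ::
  "nat \<Rightarrow> (nat \<Rightarrow> 'v) \<Rightarrow> 'v pair_pre_digraph \<Rightarrow> ('v \<times> 'v \<Rightarrow> complex) \<Rightarrow> complex mat" where
  "gain_signless_laplacian n v D \<phi> = out_degree_mat n v D + gain_adj_mat n v D \<phi>"

definition elementary_subdigraphs :: "'v pair_pre_digraph \<Rightarrow> 'v pair_pre_digraph set" where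
  "elementary_subdigraphs D =
     {E. subgraph (with_proj E) (with_proj D) \<and>
         (\<forall>u \<in> pverts E. in_degree (with_proj E) u = 1 \<and> out_degree (with_proj E) u = 1)}"

text \<open>The library's cycles are arc lists with a chosen starting point.  Passing to the set of arcs
  identifies the rotations of a cycle and nothing else, so each directed cycle is counted once.\<close>

definition dicycles :: "'v pair_pre_digraph \<Rightarrow> ('v \<times> 'v) set set" where
  "dicycles E = {set p | p. pre_digraph.cycle (with_proj E) p}"

definition num_cycles :: "'v pair_pre_digraph \<Rightarrow> nat" where
  "num_cycles E = card (dicycles E)"

definition cycle_gain :: "('v \<times> 'v \<Rightarrow> complex) \<Rightarrow> ('v \<times> 'v) set \<Rightarrow> complex" where
  "cycle_gain \<phi> C = (\<Prod>a\<in>C. \<phi> a)"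

definition gain :: "('v \<times> 'v \<Rightarrow> complex) \<Rightarrow> 'v pair_pre_digraph \<Rightarrow> complex" where
  "gain \<phi> E = (\<Prod>C\<in>dicycles E. cycle_gain \<phi> C)"

text \<open>The sums, products and cardinalities above range over finite sets, so none of them takes
  its default value.\<close>

lemma finite_elementary_subdigraphs:
  assumes "pair_digraph D"
  shows "finite (elementary_subdigraphs D)"
proof -
  interpret pair_digraph D by fact
  have "elementary_subdigraphs D \<subseteq>
      (\<lambda>(V, A). \<lparr>pverts = V, parcs = A\<rparr>) ` (Pow (pverts D) \<times> Pow (parcs D))"
  proof
    fix E :: "'a pair_pre_digraph"
    assume "E \<in> elementary_subdigraphs D"
    then have "pverts E \<subseteq> pverts D" "parcs E \<subseteq> parcs D"
      by (auto simp: elementary_subdigraphs_def subgraph_def)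
    then show "E \<in> (\<lambda>(V, A). \<lparr>pverts = V, parcs = A\<rparr>) ` (Pow (pverts D) \<times> Pow (parcs D))"
      by (intro image_eqI[of _ _ "(pverts E, parcs E)"]) auto
  qed
  then show ?thesis
    by (rule finite_subset) (simp add: pair_finite_verts pair_finite_arcs)
qed

lemma finite_dicycles:
  assumes "pair_digraph D" "E \<in> elementary_subdigraphs D"
  shows "finite (dicycles E)"
proof -
  interpret pair_digraph D by fact
  have "parcs E \<subseteq> parcs D"
    using assms(2) by (auto simp: elementary_subdigraphs_def subgraph_def)
  then have "finite (parcs E)"
    using pair_finite_arcs finite_subset by blast
  moreover have "dicycles E \<subseteq> Pow (parcs E)"
    by (auto simp: dicycles_def pre_digraph.cycle_def pre_digraph.awalk_def)
  ultimately show ?thesis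
    by (meson finite_Pow_iff finite_subset)
qed

lemma empty_elementary_subdigraph:
  assumes "pair_digraph D"
  shows "\<lparr>pverts = {}, parcs = {}\<rparr> \<in> elementary_subdigraphs D"
    and "num_cycles \<lparr>pverts = {} :: 'a set, parcs = {}\<rparr> = 0"
    and "gain \<phi> \<lparr>pverts = {} :: 'a set, parcs = {}\<rparr> = 1"
proof -
  interpret pair_digraph D by fact
  have "wf_digraph (with_proj D)" by (rule wf_digraph)
  then show "\<lparr>pverts = {}, parcs = {}\<rparr> \<in> elementary_subdigraphs D"
    by (auto simp: elementary_subdigraphs_def subgraph_def compatible_def wf_digraph_def)
  have "dicycles \<lparr>pverts = {} :: 'a set, parcs = {}\<rparr> = {}"
    by (auto simp: dicycles_def pre_digraph.cycle_def pre_digraph.awalk_def)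
  then show "num_cycles \<lparr>pverts = {} :: 'a set, parcs = {}\<rparr> = 0"
    and "gain \<phi> \<lparr>pverts = {} :: 'a set, parcs = {}\<rparr> = 1"
    by (auto simp: num_cycles_def gain_def)
qed

end

theory Submission
  imports Defs "HOL-Combinatorics.Cycles" "HOL-Combinatorics.Orbits"
begin

text \<open>In the Leibniz expansion of \<open>det (diag d + s A)\<close>, taken over the permutations \<open>f\<close> of the
  vertex set, only those \<open>f\<close> survive whose moved points satisfy \<open>(x, f x) \<in> parcs D\<close>.  As \<open>D\<close> has no
  loops, these correspond bijectively to the elementary subdigraphs: \<open>E\<close> is the set of moved points
  with the arcs \<open>(x, f x)\<close>, and its cycles are the nontrivial orbits of \<open>f\<close>.  The sign of \<open>f\<close> is
  \<open>(-1)\<close> to the power \<open>|V(E)| + c(E)\<close>; the two formulas are the cases \<open>s = -1\<close> and \<open>s = 1\<close>.\<close>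

section \<open>Sign and orbits\<close>

text \<open>A cycle on \<open>k\<close> points is a product of \<open>k - 1\<close> transpositions.
  The exponent \<open>Suc (length cs)\<close> has the same parity and avoids truncated subtraction;
  for the empty list it would give the wrong sign.\<close>

lemma sign_cycle_of_list:
  assumes "distinct cs" "cs \<noteq> []"
  shows "sign (cycle_of_list cs) = (-1) ^ (Suc (length cs))"
  using assms
proof (induction cs rule: cycle_of_list.induct)
  case (1 i j cs)
  then show ?case
    using sign_compose[OF permutation_swap_id permutation_of_cycle, of i j "j # cs"]
    by (auto simp: sign_swap_id o_def)
qed auto

text \<open>Applying the \<open>n\<close>-th iterate to the whole list rotates it by
  \<open>n\<close>, so the orbit of the head runs through the entries with index
  \<open>n mod length cs\<close>, that is, through all of them.\<close>

lemma cyclic_on_cycle_of_list: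
  assumes "distinct cs" "cs \<noteq> []"
  shows "cyclic_on (cycle_of_list cs) (set cs)"
proof (rule cyclic_on_singleI)
  let ?c = "cycle_of_list cs"
  show "hd cs \<in> set cs"
    using assms by simp
  have *: "(?c ^^ n) (hd cs) = cs ! (n mod length cs)" for n
  proof -
    have "(?c ^^ n) (hd cs) = hd (map (?c ^^ n) cs)"
      using assms by (simp add: hd_map)
    also have "\<dots> = cs ! (n mod length cs)"
      using assms by (simp add: cyclic_rotation hd_rotate_conv_nth)
    finally show ?thesis .
  qed
  have "orbit ?c (hd cs) = {(?c ^^ n) (hd cs) | n. True}"
    by (intro orbit_altdef_permutation permutation_of_cycle)
  also have "\<dots> = set cs"
  proof
    show "{(?c ^^ n) (hd cs) | n. True} \<subseteq> set cs"
      using assms by (auto simp: *)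
    show "set cs \<subseteq> {(?c ^^ n) (hd cs) | n. True}"
    proof
      fix x assume "x \<in> set cs"
      then obtain n where "n < length cs" "cs ! n = x"
        by (auto simp: in_set_conv_nth)
      then have "(?c ^^ n) (hd cs) = x"
        by (simp add: *)
      then show "x \<in> {(?c ^^ n) (hd cs) | n. True}"
        by blast
    qed
  qed
  finally show "set cs = orbit ?c (hd cs)" ..
qed

lemma cycle_decomp_permutes_finite: "cycle_decomp I p \<Longrightarrow> p permutes I \<and> finite I"
proof (induction rule: cycle_decomp.induct)
  case (comp I p cs)
  then show ?case
    using permutes_compose[OF permutes_subset[of p I "set cs \<union> I"]
        permutes_subset[OF cycle_permutes[of cs], of "set cs \<union> I"]]
    by (auto simp: o_def)
qed (simp add: permutes_id[unfolded id_def] id_def)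

text \<open>Induction on the decomposition into disjoint cycles: a further cycle of length
  \<open>k\<close> multiplies the sign by \<open>(-1) ^ (k + 1)\<close>, while it adds
  \<open>k\<close> points and one orbit. A fixed point in \<open>S\<close> adds one point and one
  orbit, so it leaves the parity alone.\<close>

lemma sign_eq_card_orbits:
  assumes "p permutes S" "finite S"
  shows "sign p = (-1) ^ (card S + card (orbit p ` S))"
  using cycle_decomposition[OF assms]
proof (induction rule: cycle_decomp.induct)
  case empty
  then show ?case by simp
next
  case (comp I p cs)
  have pI: "p permutes I" "finite I"
    using cycle_decomp_permutes_finite comp.hyps(1) by auto
  \<comment> \<open>\<open>cycle_decomp\<close> also admits an empty list as the next cycle; it adds
    no orbit and is treated apart.\<close>
  show ?case
  proof (cases "cs = []")
    case True
    then show ?thesis using comp.IH by simp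
  next
    case False
    let ?c = "cycle_of_list cs"
    let ?q = "?c \<circ> p"
    have "cyclic_on ?q (set cs)"
      using permutes_comp_preserves_cyclic1[OF pI(1) cyclic_on_cycle_of_list[OF comp.hyps(2) False], of "set cs"]
        comp.hyps(3) by simp
    then have orb_cs: "orbit ?q x = set cs" if "x \<in> set cs" for x
      using that by (simp add: orbit_cyclic_eq3)
    \<comment> \<open>The map \<open>p\<close> keeps \<open>I\<close> invariant, and the new cycle
      fixes every point of \<open>I\<close>, so both permutations agree there.\<close>
    have orb_I: "orbit ?q x = orbit p x" if "x \<in> I" for x
    proof (rule orbit_cong0[symmetric])
      show "p \<in> I \<rightarrow> I" using pI(1) by (simp add: permutes_in_image)
      fix y assume "y \<in> I"
      then have "p y \<notin> set cs"
        using comp.hyps(3) permutes_in_image[OF pI(1)] by blast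
      then show "p y = ?q y" by (simp add: id_outside_supp)
    qed fact
    have "orbit ?q ` (set cs \<union> I) = insert (set cs) (orbit p ` I)"
      using False orb_cs orb_I by (simp add: image_Un image_constant_conv cong: image_cong)
    moreover have "set cs \<notin> orbit p ` I"
    proof
      assume "set cs \<in> orbit p ` I"
      then have "set cs \<subseteq> I"
        using permutes_orbit_subset[OF pI(1)] by blast
      then show False
        using comp.hyps(3) False by (simp add: inf.absorb1)
    qed
    ultimately have "card (orbit ?q ` (set cs \<union> I)) = Suc (card (orbit p ` I))"
      using pI(2) by simp
    moreover have "card (set cs \<union> I) = length cs + card I"
      using pI(2) comp.hyps(2,3) by (simp add: card_Un_disjoint distinct_card)
    moreover have "sign ?q = sign ?c * sign p"
      using pI by (intro sign_compose permutation_of_cycle) (auto simp: permutation_permutes)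
    ultimately show ?thesis
      using comp.IH sign_cycle_of_list[OF comp.hyps(2) False] by (simp add: power_add o_def)
  qed
qed

section \<open>Cycles in the functional digraph of a permutation\<close>

definition perm_arcs :: "('v \<Rightarrow> 'v) \<Rightarrow> 'v set \<Rightarrow> ('v \<times> 'v) set" where
  "perm_arcs f S = (\<lambda>x. (x, f x)) ` S"

definition perm_walk :: "('v \<Rightarrow> 'v) \<Rightarrow> 'v \<Rightarrow> nat \<Rightarrow> ('v \<times> 'v) list" where
  "perm_walk f u m = map (\<lambda>i. ((f ^^ i) u, (f ^^ Suc i) u)) [0..<m]"

text \<open>Splitting off the first arc and restarting at \<open>f u\<close> matches the recursion
  of \<open>pcas\<close> and \<open>pawalk_verts\<close>, which drives the inductions below.\<close>

lemma perm_walk_Suc: "perm_walk f u (Suc m) = (u, f u) # perm_walk f (f u) m"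
  unfolding perm_walk_def
  by (simp add: upt_conv_Cons map_Suc_upt[symmetric] funpow_swap1 del: upt_Suc)

lemma set_perm_walk: "set (perm_walk f u m) = perm_arcs f {(f ^^ i) u | i. i < m}"
  by (force simp: perm_walk_def perm_arcs_def)

lemma pcas_perm_walk: "pcas u (perm_walk f u m) w \<longleftrightarrow> w = (f ^^ m) u"
  by (induction m arbitrary: u) (auto simp: perm_walk_Suc funpow_swap1, auto simp: perm_walk_def)

lemma pawalk_verts_perm_walk: "pawalk_verts u (perm_walk f u m) = map (\<lambda>i. (f ^^ i) u) [0..<Suc m]"
proof (induction m arbitrary: u)
  case (Suc m)
  have "map (\<lambda>i. (f ^^ i) u) [0..<Suc (Suc m)] = u # map (\<lambda>i. (f ^^ i) (f u)) [0..<Suc m]"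
    by (subst upt_conv_Cons, simp, subst map_Suc_upt[symmetric])
      (simp add: funpow_swap1 del: upt_Suc)
  then show ?case
    using Suc by (simp add: perm_walk_Suc)
qed (simp add: perm_walk_def)

text \<open>Only one arc leaves each vertex here, so a walk is determined by its start and its
  length.\<close>

lemma pcas_perm_arcs_imp_perm_walk:
  assumes "pcas u p w" "set p \<subseteq> perm_arcs f S"
  shows "p = perm_walk f u (length p)"
  using assms
  by (induction p arbitrary: u) (auto simp: perm_walk_Suc perm_arcs_def, auto simp: perm_walk_def)

text \<open>A nonempty closed walk must follow \<open>f\<close> until it is back at its start, and
  so traverses a whole orbit. Conversely, following \<open>f\<close> from \<open>u\<close> up to the
  first return gives a cycle through the orbit of \<open>u\<close>.\<close>

lemma dicycles_permutation:
  assumes f: "f permutes pverts E" and fin: "finite (pverts E)"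
    and arcs: "parcs E = perm_arcs f (pverts E)"
  shows "dicycles E = perm_arcs f ` orbit f ` pverts E"
proof (intro subset_antisym subsetI)
  have perm: "permutation f"
    using f fin by (auto simp: permutation_permutes)
  interpret pair_pre_digraph E .
  fix C
  {
    assume "C \<in> dicycles E"
    then obtain p u where p: "C = set p" "u \<in> pverts E" "set p \<subseteq> parcs E" "pcas u p u" "p \<noteq> []"
      by (auto simp: dicycles_def cycle_def awalk_def)
    define m where "m = length p"
    have walk: "p = perm_walk f u m"
      unfolding m_def using p(3,4) by (intro pcas_perm_arcs_imp_perm_walk) (auto simp: arcs)
    have "(f ^^ m) u = u"
      using p(4) by (simp add: walk pcas_perm_walk)
    moreover have "0 < m"
      using p(5) by (simp add: m_def)
    ultimately have "orbit f u = {(f ^^ i) u | i. i < m}"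
      by (rule orbit_altdef_bounded)
    then have "C = perm_arcs f (orbit f u)"
      using p(1) walk by (simp add: set_perm_walk)
    then show "C \<in> perm_arcs f ` orbit f ` pverts E"
      using p(2) by blast
  next
    assume "C \<in> perm_arcs f ` orbit f ` pverts E"
    then obtain u where u: "C = perm_arcs f (orbit f u)" "u \<in> pverts E"
      by blast
    have self: "u \<in> orbit f u"
      by (rule permutation_self_in_orbit[OF perm])
    \<comment> \<open>The first return time: minimality makes the first \<open>m\<close> iterates
      distinct.\<close>
    define m where "m = funpow_dist1 f u u"
    have m: "(f ^^ m) u = u" "0 < m"
      unfolding m_def by (rule funpow_dist1_prop[OF self]) simp
    have C: "set (perm_walk f u m) = C"
      using orbit_altdef_bounded[OF m] u(1) by (simp add: set_perm_walk)
    have "perm_arcs f (orbit f u) \<subseteq> parcs E"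
      using permutes_orbit_subset[OF f u(2)] by (auto simp: arcs perm_arcs_def)
    \<comment> \<open>\<open>cycle\<close> asks for distinctness of the vertex list without its
      first entry. These are the iterates \<open>1\<close> to \<open>m\<close>, the images under the
      injective \<open>f\<close> of the iterates \<open>0\<close> to \<open>m - 1\<close>.\<close>
    moreover have "tl (pawalk_verts u (perm_walk f u m)) = map (f \<circ> (\<lambda>i. (f ^^ i) u)) [0..<m]"
      by (subst pawalk_verts_perm_walk, subst upt_conv_Cons, simp, subst map_Suc_upt[symmetric])
        (simp del: upt_Suc)
    moreover have "inj_on (\<lambda>i. (f ^^ i) u) {0..<m}"
      unfolding m_def by (rule inj_on_funpow_dist1[OF self])
    then have "inj_on (f \<circ> (\<lambda>i. (f ^^ i) u)) {0..<m}"
      by (rule comp_inj_on) (rule permutes_inj_on[OF f])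
    moreover have "perm_walk f u m \<noteq> []"
      using m(2) by (simp add: perm_walk_def)
    ultimately have "cycle (perm_walk f u m)"
      unfolding cycle_def awalk_def
      using u(2) m(1) by (intro exI[of _ u]) (simp add: C u(1) pcas_perm_walk distinct_map)
    then show "C \<in> dicycles E"
      using C by (auto simp: dicycles_def)
  }
qed

text \<open>The tails of the arcs recover the set. Distinct orbits therefore give distinct cycles,
  and counts or products over cycles become counts or products over orbits.\<close>

lemma inj_perm_arcs: "inj (perm_arcs f)"
  by (rule inj_on_inverseI[of _ "\<lambda>A. fst ` A"]) (simp add: perm_arcs_def image_image)

lemma num_cycles_permutation:
  assumes "f permutes pverts E" "finite (pverts E)" "parcs E = perm_arcs f (pverts E)"
  shows "num_cycles E = card (orbit f ` pverts E)"
  unfolding num_cycles_def dicycles_permutation[OF assms]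
  by (intro card_image inj_on_subset[OF inj_perm_arcs]) auto

text \<open>The orbits partition the vertex set, so the product of the cycle gains takes each arc
  \<open>(x, f x)\<close> exactly once.\<close>

lemma gain_permutation:
  assumes f: "f permutes pverts E" and fin: "finite (pverts E)"
    and arcs: "parcs E = perm_arcs f (pverts E)"
  shows "gain \<phi> E = (\<Prod>x\<in>pverts E. \<phi> (x, f x))"
proof -
  have perm: "permutation f"
    using f fin by (auto simp: permutation_permutes)
  have cyc: "cycle_gain \<phi> (perm_arcs f S) = (\<Prod>x\<in>S. \<phi> (x, f x))" for S
    unfolding cycle_gain_def perm_arcs_def by (subst prod.reindex) (auto simp: inj_on_def)
  have "gain \<phi> E = (\<Prod>S\<in>orbit f ` pverts E. \<Prod>x\<in>S. \<phi> (x, f x))"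
    unfolding gain_def dicycles_permutation[OF assms]
    by (subst prod.reindex) (auto intro: inj_on_subset[OF inj_perm_arcs] simp: cyc)
  also have "\<dots> = (\<Prod>x\<in>\<Union>(orbit f ` pverts E). \<phi> (x, f x))"
  proof (rule prod.Union_disjoint[symmetric, unfolded o_def])
    show "\<forall>A\<in>orbit f ` pverts E. finite A"
      using finite_orbit[OF permutation_self_in_orbit[OF perm]] by blast
    show "\<forall>A\<in>orbit f ` pverts E. \<forall>B\<in>orbit f ` pverts E. A \<noteq> B \<longrightarrow> A \<inter> B = {}"
      using orbit_cyclic_eq3[OF cyclic_on_orbit'[OF perm]] by (metis disjoint_iff imageE)
  qed
  also have "\<Union>(orbit f ` pverts E) = pverts E"
    using permutes_orbit_subset[OF f] permutation_self_in_orbit[OF perm] by blast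
  finally show ?thesis .
qed

section \<open>Elementary subdigraphs as permutations\<close>

text \<open>Fixed points are left out because they would produce loops; they are the vertices that
  an elementary subdigraph does not cover.\<close>

definition moved_digraph :: "('v \<Rightarrow> 'v) \<Rightarrow> 'v pair_pre_digraph" where
  "moved_digraph f = \<lparr>pverts = {x. f x \<noteq> x}, parcs = perm_arcs f {x. f x \<noteq> x}\<rparr>"

lemma moved_digraph_simps [simp]:
  "pverts (moved_digraph f) = {x. f x \<noteq> x}"
  "parcs (moved_digraph f) = perm_arcs f {x. f x \<noteq> x}"
  by (simp_all add: moved_digraph_def)

text \<open>The permutations whose Leibniz term can be nonzero. A fixed point carries no condition,
  since it selects a diagonal entry.\<close>

definition arc_permutations :: "'v pair_pre_digraph \<Rightarrow> ('v \<Rightarrow> 'v) set" where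
  "arc_permutations D = {f. f permutes pverts D \<and> (\<forall>x. f x \<noteq> x \<longrightarrow> (x, f x) \<in> parcs D)}"

lemma permutes_moved: "f permutes S \<Longrightarrow> f permutes {x. f x \<noteq> x}"
  by (rule permutes_superset) auto

text \<open>The vertices tell which points are moved, and the arcs tell where they go.\<close>

lemma inj_moved_digraph: "inj moved_digraph"
proof (rule injI, rule ext)
  fix f g :: "'a \<Rightarrow> 'a" and x
  assume "moved_digraph f = moved_digraph g"
  then have "{x. f x \<noteq> x} = {x. g x \<noteq> x}"
    "perm_arcs f {x. f x \<noteq> x} = perm_arcs g {x. g x \<noteq> x}"
    by (auto simp: moved_digraph_def)
  then show "f x = g x"
    by (auto simp: perm_arcs_def set_eq_iff image_iff) metis
qed

lemma moved_digraph_elementary: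
  assumes "pair_digraph D" "f \<in> arc_permutations D"
  shows "moved_digraph f \<in> elementary_subdigraphs D"
proof -
  interpret pair_digraph D by fact
  have f: "f permutes pverts D" and arc: "\<And>x. f x \<noteq> x \<Longrightarrow> (x, f x) \<in> parcs D"
    using assms(2) by (auto simp: arc_permutations_def)
  have inj: "f x = f y \<longleftrightarrow> x = y" for x y
    using permutes_inj[OF f] by (auto dest: injD)
  \<comment> \<open>Heads of arcs are vertices again: by injectivity, \<open>f x\<close> is moved
    whenever \<open>x\<close> is.\<close>
  have "wf_digraph (with_proj (moved_digraph f))"
    by unfold_locales (auto simp: perm_arcs_def inj)
  moreover have "pverts (moved_digraph f) \<subseteq> pverts D"
    using permutes_not_in[OF f] by auto
  moreover have "parcs (moved_digraph f) \<subseteq> parcs D"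
    using arc by (auto simp: perm_arcs_def)
  ultimately have "subgraph (with_proj (moved_digraph f)) (with_proj D)"
    using wf_digraph by (simp add: subgraph_def compatible_def)
  moreover have "in_degree (with_proj (moved_digraph f)) u = 1" if u: "f u \<noteq> u" for u
  proof -
    \<comment> \<open>The preimage \<open>w\<close> is itself moved: if \<open>f w = w\<close>, then
      \<open>u = w\<close> would be fixed.\<close>
    obtain w where w: "u = f w"
      using permutes_surj[OF f] by (auto simp: surj_def)
    then have "in_arcs (with_proj (moved_digraph f)) u = {(w, u)}"
      using u by (auto simp: in_arcs_def perm_arcs_def inj)
    then show ?thesis by (simp add: in_degree_def)
  qed
  moreover have "out_degree (with_proj (moved_digraph f)) u = 1" if u: "f u \<noteq> u" for u
  proof -
    have "out_arcs (with_proj (moved_digraph f)) u = {(u, f u)}"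
      using u by (auto simp: out_arcs_def perm_arcs_def)
    then show ?thesis by (simp add: out_degree_def)
  qed
  ultimately show ?thesis
    by (simp add: elementary_subdigraphs_def)
qed

text \<open>Out-degree 1 makes the arcs of \<open>E\<close> a function on its vertices, in-degree 1
  makes this function bijective, and the absence of loops makes it move every vertex of
  \<open>E\<close>.\<close>

lemma elementary_imp_moved_digraph:
  assumes "pair_digraph D" "E \<in> elementary_subdigraphs D"
  shows "E \<in> moved_digraph ` arc_permutations D"
proof -
  interpret pair_digraph D by fact
  have verts: "pverts E \<subseteq> pverts D" and arcs: "parcs E \<subseteq> parcs D"
    and wf: "wf_digraph (with_proj E)"
    and deg: "\<And>u. u \<in> pverts E \<Longrightarrow>
      card (in_arcs (with_proj E) u) = 1 \<and> card (out_arcs (with_proj E) u) = 1"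
    using assms(2)
    by (auto simp: elementary_subdigraphs_def subgraph_def in_degree_def out_degree_def)
  have ends: "x \<in> pverts E" "y \<in> pverts E" "x \<noteq> y" if "(x, y) \<in> parcs E" for x y
    using wf_digraph.tail_in_verts[OF wf, of "(x, y)"] wf_digraph.head_in_verts[OF wf, of "(x, y)"]
      pair_no_loops[of "(x, y)"] arcs that by auto
  have out: "\<exists>!y. (x, y) \<in> parcs E" if x: "x \<in> pverts E" for x
  proof -
    obtain a b where "out_arcs (with_proj E) x = {(a, b)}"
      using deg[OF x] card_1_singletonE by (metis surj_pair)
    then have "(a', b') \<in> parcs E \<and> a' = x \<longleftrightarrow> a' = a \<and> b' = b" for a' b'
      by (auto simp: out_arcs_def set_eq_iff)
    then show ?thesis
      by metis
  qed
  have into: "\<exists>!x. (x, y) \<in> parcs E" if y: "y \<in> pverts E" for y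
  proof -
    obtain a b where "in_arcs (with_proj E) y = {(a, b)}"
      using deg[OF y] card_1_singletonE by (metis surj_pair)
    then have "(a', b') \<in> parcs E \<and> b' = y \<longleftrightarrow> a' = a \<and> b' = b" for a' b'
      by (auto simp: in_arcs_def set_eq_iff)
    then show ?thesis
      by metis
  qed
  \<comment> \<open>By \<open>out\<close> the description is proper on \<open>pverts E\<close>; the
    identity elsewhere makes \<open>f\<close> a permutation of all of
    \<open>pverts D\<close>.\<close>
  define f where "f x = (if x \<in> pverts E then THE y. (x, y) \<in> parcs E else x)" for x
  have arc_iff: "(x, y) \<in> parcs E \<longleftrightarrow> y = f x" if "x \<in> pverts E" for x y
    using theI'[OF out[OF that]] out[OF that] that by (auto simp: f_def)
  then have f_arc: "(x, f x) \<in> parcs E" if "x \<in> pverts E" for x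
    using that by blast
  have moved: "{x. f x \<noteq> x} = pverts E"
  proof (intro subset_antisym subsetI)
    fix x assume "x \<in> {x. f x \<noteq> x}"
    then show "x \<in> pverts E"
      by (auto simp: f_def split: if_splits)
  next
    fix x assume "x \<in> pverts E"
    then have "x \<noteq> f x"
      by (rule ends(3)[OF f_arc])
    then show "x \<in> {x. f x \<noteq> x}"
      by simp
  qed
  have "bij_betw f (pverts E) (pverts E)"
    unfolding bij_betw_def
  proof
    show "inj_on f (pverts E)"
    proof (rule inj_onI)
      fix x y assume xy: "x \<in> pverts E" "y \<in> pverts E" "f x = f y"
      then have "(x, f y) \<in> parcs E" "(y, f y) \<in> parcs E"
        using f_arc by metis+
      \<comment> \<open>Two preimages of one vertex would be two arcs entering it.\<close>
      then show "x = y"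
        using into[OF ends(2)] by blast
    qed
    show "f ` pverts E = pverts E"
    proof (intro subset_antisym subsetI)
      fix y assume "y \<in> f ` pverts E"
      then show "y \<in> pverts E"
        using ends(2)[OF f_arc] by auto
    next
      fix y assume "y \<in> pverts E"
      then obtain x where x: "(x, y) \<in> parcs E"
        using into by blast
      then show "y \<in> f ` pverts E"
        using ends(1)[OF x] arc_iff by blast
    qed
  qed
  then have "f permutes pverts E"
    by (rule bij_imp_permutes) (simp add: f_def)
  then have "f permutes pverts D"
    using verts by (rule permutes_subset)
  moreover have "(x, f x) \<in> parcs D" if "f x \<noteq> x" for x
    using f_arc arcs moved that by blast
  ultimately have "f \<in> arc_permutations D"
    by (simp add: arc_permutations_def)
  moreover have "parcs E = perm_arcs f (pverts E)"
  proof (intro subset_antisym subsetI)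
    fix a assume a: "a \<in> parcs E"
    obtain x y where xy: "a = (x, y)"
      by (cases a)
    then have "x \<in> pverts E"
      using a ends(1) by blast
    then show "a \<in> perm_arcs f (pverts E)"
      using a xy arc_iff by (simp add: perm_arcs_def)
  next
    fix a assume "a \<in> perm_arcs f (pverts E)"
    then show "a \<in> parcs E"
      using f_arc by (auto simp: perm_arcs_def)
  qed
  then have "E = moved_digraph f"
    using moved by (simp add: moved_digraph_def)
  ultimately show ?thesis by blast
qed

lemma bij_betw_moved_digraph:
  assumes "pair_digraph D"
  shows "bij_betw moved_digraph (arc_permutations D) (elementary_subdigraphs D)"
  unfolding bij_betw_def
  using moved_digraph_elementary[OF assms] elementary_imp_moved_digraph[OF assms]
    inj_on_subset[OF inj_moved_digraph]
  by blast

section \<open>Determinant expansion\<close>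

text \<open>The Leibniz formula transported along the enumeration \<open>v\<close>: relabelling the
  indices by vertices conjugates each permutation and so preserves its sign.\<close>

lemma det_mat_reindex:
  assumes v: "bij_betw v {0..<n} V"
  shows "det (mat n n (\<lambda>(i, j). M (v i) (v j)) :: 'a :: comm_ring_1 mat) =
    (\<Sum>f | f permutes V. of_int (sign f) * (\<Prod>x\<in>V. M x (f x)))"
proof -
  let ?m = "map_permutation {0..<n} v"
  have inj: "inj_on v {0..<n}" and V: "V = v ` {0..<n}"
    using v by (auto simp: bij_betw_def)
  have bij: "bij_betw ?m {p. p permutes {0..<n}} {f. f permutes V}"
  proof (rule bij_betw_byWitness[of _ "map_permutation V (inv_into {0..<n} v)"])
    show "\<forall>p\<in>{p. p permutes {0..<n}}. map_permutation V (inv_into {0..<n} v) (?m p) = p"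
      using v by (auto intro!: map_permutation_compose_inv simp: inj inv_into_f_f)
    show "\<forall>f\<in>{f. f permutes V}. ?m (map_permutation V (inv_into {0..<n} v) f) = f"
      using bij_betw_inv_into[OF v]
      by (auto intro!: map_permutation_compose_inv simp: V f_inv_into_f)
    show "?m ` {p. p permutes {0..<n}} \<subseteq> {f. f permutes V}"
      using map_permutation_permutes[OF v] by auto
    show "map_permutation V (inv_into {0..<n} v) ` {f. f permutes V} \<subseteq> {p. p permutes {0..<n}}"
      using map_permutation_permutes[OF bij_betw_inv_into[OF v]] by auto
  qed
  have "det (mat n n (\<lambda>(i, j). M (v i) (v j))) =
      (\<Sum>p | p permutes {0..<n}. of_int (sign p) * (\<Prod>i = 0..<n. M (v i) (v (p i))))"
    by (subst det_def'[of _ n]) (auto intro!: sum.cong prod.cong simp: permutes_in_image)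
  also have "\<dots> = (\<Sum>p | p permutes {0..<n}. of_int (sign (?m p)) * (\<Prod>x\<in>V. M x (?m p x)))"
  proof (intro sum.cong refl, clarify)
    fix p assume p: "p permutes {0..<n}"
    have "(\<Prod>x\<in>V. M x (?m p x)) = (\<Prod>i = 0..<n. M (v i) (v (p i)))"
      unfolding V by (subst prod.reindex[OF inj])
        (auto intro!: prod.cong simp: map_permutation_apply[OF inj])
    then show "of_int (sign p) * (\<Prod>i = 0..<n. M (v i) (v (p i))) =
        of_int (sign (?m p)) * (\<Prod>x\<in>V. M x (?m p x))"
      using sign_map_permutation[OF inj p] by simp
  qed
  also have "\<dots> = (\<Sum>f | f permutes V. of_int (sign f) * (\<Prod>x\<in>V. M x (f x)))"
    by (rule sum.reindex_bij_betw[OF bij])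
  finally show ?thesis .
qed

text \<open>The factor \<open>(- s) ^ card (pverts E)\<close> joins one \<open>s\<close> per chosen
  arc with the vertex part of the sign of the permutation; its cycle part is
  \<open>(-1) ^ num_cycles E\<close>.\<close>

lemma det_elementary_expansion:
  fixes d :: "'v \<Rightarrow> complex" and s :: complex
  assumes D: "pair_digraph D" and v: "bij_betw v {0..<n} (pverts D)"
  shows "det (mat n n (\<lambda>(i, j). (if v i = v j then d (v i) else 0) +
             s * (if (v i, v j) \<in> parcs D then \<phi> (v i, v j) else 0))) =
    (\<Sum>E \<in> elementary_subdigraphs D.
       (- s) ^ card (pverts E) * (-1) ^ num_cycles E * gain \<phi> E * (\<Prod>u \<in> pverts D - pverts E. d u))"
proof -
  interpret pair_digraph D by fact
  define M where "M x y = (if x = y then d x else 0) + s * (if (x, y) \<in> parcs D then \<phi> (x, y) else 0)"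
    for x y
  let ?t = "\<lambda>f. of_int (sign f) * (\<Prod>x\<in>pverts D. M x (f x))"
  let ?w = "\<lambda>E. (- s) ^ card (pverts E) * (-1) ^ num_cycles E * gain \<phi> E *
    (\<Prod>u \<in> pverts D - pverts E. d u)"
  have "det (mat n n (\<lambda>(i, j). M (v i) (v j))) = (\<Sum>f | f permutes pverts D. ?t f)"
    by (rule det_mat_reindex[OF v])
  also have "\<dots> = (\<Sum>f \<in> arc_permutations D. ?t f)"
  proof (rule sum.mono_neutral_right)
    show "finite {f. f permutes pverts D}"
      by (rule finite_permutations) (rule pair_finite_verts)
    show "arc_permutations D \<subseteq> {f. f permutes pverts D}"
      by (auto simp: arc_permutations_def)
    show "\<forall>f \<in> {f. f permutes pverts D} - arc_permutations D. ?t f = 0"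
    proof
      fix f assume "f \<in> {f. f permutes pverts D} - arc_permutations D"
      then obtain x where f: "f permutes pverts D" and x: "f x \<noteq> x" "(x, f x) \<notin> parcs D"
        by (auto simp: arc_permutations_def)
      \<comment> \<open>A moved point whose arc is missing contributes a zero factor: the entry is
        off the diagonal and has no gain.\<close>
      have "x \<in> pverts D" "M x (f x) = 0"
        using x permutes_not_in[OF f] by (auto simp: M_def)
      then show "?t f = 0"
        using pair_finite_verts by (auto intro!: prod_zero)
    qed
  qed
  also have "\<dots> = (\<Sum>f \<in> arc_permutations D. ?w (moved_digraph f))"
  proof (rule sum.cong[OF refl])
    fix f assume "f \<in> arc_permutations D"
    then have f: "f permutes pverts D" and arc: "\<And>x. f x \<noteq> x \<Longrightarrow> (x, f x) \<in> parcs D"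
      by (auto simp: arc_permutations_def)
    let ?S = "{x. f x \<noteq> x}"
    have sub: "?S \<subseteq> pverts D"
      using permutes_not_in[OF f] by auto
    then have fin: "finite ?S"
      using pair_finite_verts finite_subset by blast
    have moved: "f permutes pverts (moved_digraph f)" "finite (pverts (moved_digraph f))"
      "parcs (moved_digraph f) = perm_arcs f (pverts (moved_digraph f))"
      using permutes_moved[OF f] fin by auto
    have "(\<Prod>x\<in>pverts D. M x (f x)) = (\<Prod>x\<in>pverts D - ?S. M x (f x)) * (\<Prod>x\<in>?S. M x (f x))"
      by (rule prod.subset_diff[OF sub]) (rule pair_finite_verts)
    \<comment> \<open>At fixed points the gain part vanishes, as \<open>D\<close> has no loops; at
      moved points the diagonal part vanishes and the arc is present.\<close>
    also have "(\<Prod>x\<in>pverts D - ?S. M x (f x)) = (\<Prod>x\<in>pverts D - ?S. d x)"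
      by (intro prod.cong) (auto simp: M_def dest: pair_no_loops)
    also have "(\<Prod>x\<in>?S. M x (f x)) = (\<Prod>x\<in>?S. s * \<phi> (x, f x))"
      using arc by (intro prod.cong) (auto simp: M_def)
    also have "\<dots> = s ^ card ?S * gain \<phi> (moved_digraph f)"
      using gain_permutation[OF moved, of \<phi>] by (simp add: prod.distrib)
    finally have "(\<Prod>x\<in>pverts D. M x (f x)) =
        (\<Prod>x\<in>pverts D - ?S. d x) * (s ^ card ?S * gain \<phi> (moved_digraph f))" .
    moreover have "sign f = (-1) ^ (card ?S + num_cycles (moved_digraph f))"
      using sign_eq_card_orbits[OF moved(1,2)] num_cycles_permutation[OF moved] by simp
    moreover have "(- s) ^ card ?S = (-1) ^ card ?S * s ^ card ?S"
      by (rule power_minus)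
    ultimately show "?t f = ?w (moved_digraph f)"
      by (simp add: power_add mult_ac)
  qed
  also have "\<dots> = (\<Sum>E \<in> elementary_subdigraphs D. ?w E)"
    by (rule sum.reindex_bij_betw[OF bij_betw_moved_digraph[OF D]])
  finally show ?thesis
    unfolding M_def .
qed

theorem theorem5p1:
  fixes D :: "'v pair_pre_digraph"
    and \<phi> :: "'v \<times> 'v \<Rightarrow> complex"
    and n :: nat
    and v :: "nat \<Rightarrow> 'v"
  assumes "T_gain_digraph D \<phi>"
    and "bij_betw v {0..<n} (pverts D)"
  shows "det (gain_laplacian n v D \<phi>) =
           (\<Sum>E \<in> elementary_subdigraphs D.
              (-1) ^ num_cycles E * gain \<phi> E *
              (\<Prod>u \<in> pverts D - pverts E. of_nat (out_degree (with_proj D) u)))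
       \<and> det (gain_signless_laplacian n v D \<phi>) =
           (\<Sum>E \<in> elementary_subdigraphs D.
              (-1) ^ (card (pverts E) + num_cycles E) * gain \<phi> E *
              (\<Prod>u \<in> pverts D - pverts E. of_nat (out_degree (with_proj D) u)))"
proof -
  have D: "pair_digraph D"
    using assms(1) by (simp add: T_gain_digraph_def)
  \<comment> \<open>Turns the vertex test \<open>v i = v j\<close> on the diagonal of
    \<open>?M\<close> into the index test of \<open>mat_diag\<close>.\<close>
  have inj: "i < n \<Longrightarrow> j < n \<Longrightarrow> v i = v j \<longleftrightarrow> i = j" for i j
    using assms(2) by (auto simp: bij_betw_def inj_on_eq_iff)
  let ?M = "\<lambda>s. mat n n (\<lambda>(i, j). (if v i = v j then of_nat (out_degree (with_proj D) (v i)) else 0) +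
             s * (if (v i, v j) \<in> parcs D then \<phi> (v i, v j) else 0))"
  have L: "gain_laplacian n v D \<phi> = ?M (-1)"
    by (rule eq_matI)
      (auto simp: gain_laplacian_def out_degree_mat_def gain_adj_mat_def mat_diag_def inj)
  have Q: "gain_signless_laplacian n v D \<phi> = ?M 1"
    by (rule eq_matI)
      (auto simp: gain_signless_laplacian_def out_degree_mat_def gain_adj_mat_def mat_diag_def inj)
  \<comment> \<open>The factor \<open>(- s) ^ card (pverts E)\<close> is 1 for
    \<open>s = -1\<close>; for \<open>s = 1\<close> it merges with the power of \<open>-1\<close>
    that counts cycles.\<close>
  show ?thesis
    unfolding L Q
      det_elementary_expansion[OF D assms(2), where d = "\<lambda>u. of_nat (out_degree (with_proj D) u)"]
    by (simp add: power_add)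
qed

end
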